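(* Let $X$ be a Tychonoff space and let $E$ be any set of functions with $L(X)\subseteq E\subseteq C(X_{\aleph_0})$, endowed with the topology of pointwise convergence. Then $\psi(E)=\psi w(E)=i\chi(E)=iw(E)=d(X_{\aleph_0})$.
   Context: All spaces are Tychonoff. A zero-set of $X$ is a set $\{x\in X: f(x)=0\}$ with $f:X\to\mathbb{R}$ continuous; $Z(X)$ is the family of all zero-sets of $X$. $X_{\aleph_0}$ is the set $X$ with the (Baire) topology having $Z(X)$ as a base. $C(X_{\aleph_0})$ is the set of all continuous real-valued functions on $X_{\aleph_0}$. $L(X)=\{n_1 f_{Z_1}+\dots+n_k f_{Z_k}: k\in\mathbb{N},\ n_i\in\mathbb{N},\ Z_i\in Z(X)\}$, where $f_Z$ is the characteristic function of $Z\subseteq X$. The topology of pointwise convergence on $E$ is the subspace topology from $\mathbb{R}^X$. For a space $Y$: $\psi(Y)$ is the pseudocharacter; $\psi w(Y)$ is the pseudoweight, i.e. the least cardinality of a family $\mathcal{V}$ of open subsets of $Y$ such that $\bigcap\{V\in\mathcal{V}: y\in V\}=\{y\}$ for every $y\in Y$; $\chi$, $w$, $d$ are character, weight, density; and for $\epsilon\in\{\chi,w\}$, $i\epsilon(Y)=\min\{\epsilon(Z): Y$ admits a one-to-one continuous mapping onto a (Tychonoff) space $Z\}$. As is standard, values of cardinal functions are taken to be infinite cardinals (at least $\omega_0$). *)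

theory Defs
  imports "HOL-Analysis.Analysis"
begin

unbundle cardinal_syntax
(* this input notation for membership clashes with the equality of cardinals *)
no_notation elt_set_eq (infix "=o" 50)

section \<open>Minima and suprema of cardinals\<close>

text \<open>
  A cardinal is represented by a cardinal order on some type, and cardinals living on
  different types are compared by \<open>\<le>o\<close> and \<open>=o\<close>. Every nonempty set of cardinal orders has a
  least element, unique up to \<open>=o\<close>.
\<close>

definition card_min :: "'c rel set \<Rightarrow> 'c rel" where
  "card_min K = (SOME r. r \<in> K \<and> (\<forall>s\<in>K. r \<le>o s))"

text \<open>
  The supremum of \<open>K\<close> among the infinite cardinals. Taking it on the type \<open>'c + nat\<close> leaves room
  for \<open>natLeq\<close> (that is, \<open>\<omega>\<^sub>0\<close>) even if \<open>'c\<close> is finite; as every cardinal below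
  \<open>|UNIV :: ('c + nat) set|\<close> has a representative on \<open>'c + nat\<close>, this is the true supremum.
\<close>

definition card_sup :: "'c rel set \<Rightarrow> ('c + nat) rel" where
  "card_sup K = card_min {r. Card_order r \<and> natLeq \<le>o r \<and> (\<forall>s\<in>K. s \<le>o r)}"

lemma card_min:
  assumes "K \<noteq> {}" "\<And>r. r \<in> K \<Longrightarrow> Card_order r"
  shows "card_min K \<in> K" and "\<And>s. s \<in> K \<Longrightarrow> card_min K \<le>o s"
proof -
  have "\<exists>r. r \<in> K \<and> (\<forall>s\<in>K. r \<le>o s)"
    using exists_minim_Card_order[of K] assms by blast
  then have "card_min K \<in> K \<and> (\<forall>s\<in>K. card_min K \<le>o s)"
    unfolding card_min_def by (rule someI_ex)
  then show "card_min K \<in> K" and "\<And>s. s \<in> K \<Longrightarrow> card_min K \<le>o s"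
    by auto
qed

lemma card_sup:
  fixes K :: "'c rel set"
  assumes "\<And>s. s \<in> K \<Longrightarrow> Card_order s"
  shows "Card_order (card_sup K)" and "natLeq \<le>o card_sup K"
    and "\<And>s. s \<in> K \<Longrightarrow> s \<le>o card_sup K"
    and "\<And>r :: 'd rel. \<lbrakk>Card_order r; natLeq \<le>o r; \<And>s. s \<in> K \<Longrightarrow> s \<le>o r\<rbrakk> \<Longrightarrow> card_sup K \<le>o r"
proof -
  define R :: "('c + nat) rel set"
    where "R = {r. Card_order r \<and> natLeq \<le>o r \<and> (\<forall>s\<in>K. s \<le>o r)}"
  have sup: "card_sup K = card_min R"
    by (simp add: card_sup_def R_def)
  let ?u = "|UNIV :: ('c + nat) set|"
  have "natLeq \<le>o ?u"
    using ordIso_ordLeq_trans[OF ordIso_symmetric[OF card_of_nat], of ?u]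
      card_of_Plus2[of "UNIV :: nat set" "UNIV :: 'c set"] by simp
  moreover have "s \<le>o ?u" if "s \<in> K" for s
  proof -
    have "|Field s| \<le>o |UNIV :: 'c set|" by (rule card_of_mono1) simp
    moreover have "|UNIV :: 'c set| \<le>o ?u"
      using card_of_Plus1[of "UNIV :: 'c set" "UNIV :: nat set"] by simp
    ultimately have "|Field s| \<le>o ?u" by (rule ordLeq_transitive)
    with ordIso_symmetric[OF card_of_Field_ordIso[OF assms[OF that]]] show ?thesis
      by (rule ordIso_ordLeq_trans)
  qed
  ultimately have u: "?u \<in> R"
    by (simp add: R_def card_of_Card_order)
  then have ne: "R \<noteq> {}" by blast
  have co: "\<And>r. r \<in> R \<Longrightarrow> Card_order r" by (simp add: R_def)
  have mem: "card_sup K \<in> R" and le: "\<And>s. s \<in> R \<Longrightarrow> card_sup K \<le>o s"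
    unfolding sup using card_min[OF ne co] by auto
  show "Card_order (card_sup K)" "natLeq \<le>o card_sup K" "\<And>s. s \<in> K \<Longrightarrow> s \<le>o card_sup K"
    using mem by (auto simp: R_def)
  show "card_sup K \<le>o r"
    if r: "Card_order r" "natLeq \<le>o r" "\<And>s. s \<in> K \<Longrightarrow> s \<le>o r" for r :: "'d rel"
  proof (cases "?u \<le>o r")
    case True
    with le[OF u] show ?thesis by (rule ordLeq_transitive)
  next
    case False
    have F: "|Field r| =o r" by (rule card_of_Field_ordIso[OF r(1)])
    have "Well_order r" using r(1) by (simp add: card_order_on_def)
    with False have "r \<le>o ?u"
      using ordLeq_total[OF card_of_Well_order] by blast
    with F have "|Field r| \<le>o ?u" by (rule ordIso_ordLeq_trans)
    then obtain f :: "'d \<Rightarrow> 'c + nat" where f: "inj_on f (Field r)"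
      unfolding card_of_ordLeq[symmetric] by blast
    have iso: "r =o |f ` Field r|"
      by (rule ordIso_transitive[OF ordIso_symmetric[OF F]
            card_of_ordIsoI[OF inj_on_imp_bij_betw[OF f]]])
    have "|f ` Field r| \<in> R"
      using ordLeq_ordIso_trans[OF r(2) iso] ordLeq_ordIso_trans[OF r(3) iso]
      by (simp add: R_def card_of_Card_order)
    then have "card_sup K \<le>o |f ` Field r|" by (rule le)
    then show ?thesis using ordIso_symmetric[OF iso] by (rule ordLeq_ordIso_trans)
  qed
qed

section \<open>Cardinal functions\<close>

text \<open>
  All values are infinite cardinals: a possibly finite value \<open>\<kappa>\<close> is replaced by \<open>\<kappa> +c natLeq\<close>,
  which is the maximum of \<open>\<kappa>\<close> and \<open>\<omega>\<^sub>0\<close>.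
\<close>

definition tychonoff_space :: "'a topology \<Rightarrow> bool" where
  "tychonoff_space X \<longleftrightarrow> completely_regular_space X \<and> t1_space X"

definition pseudocharacter_at :: "'a topology \<Rightarrow> 'a \<Rightarrow> 'a set rel" where
  "pseudocharacter_at Y y = card_min {|\<V>| | \<V>. (\<forall>V\<in>\<V>. openin Y V) \<and> \<Inter>\<V> = {y}}"

definition pseudocharacter :: "'a topology \<Rightarrow> ('a set + nat) rel" where
  "pseudocharacter Y = card_sup (pseudocharacter_at Y ` topspace Y)"

definition pseudoweight :: "'a topology \<Rightarrow> ('a set + nat) rel" where
  "pseudoweight Y =
     card_min {|\<V>| | \<V>. (\<forall>V\<in>\<V>. openin Y V) \<and> (\<forall>y\<in>topspace Y. \<Inter>{V\<in>\<V>. y \<in> V} = {y})} +c natLeq"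

definition character_at :: "'a topology \<Rightarrow> 'a \<Rightarrow> 'a set rel" where
  "character_at Y y =
     card_min {|\<B>| | \<B>. (\<forall>V\<in>\<B>. openin Y V \<and> y \<in> V) \<and>
                        (\<forall>U. openin Y U \<and> y \<in> U \<longrightarrow> (\<exists>V\<in>\<B>. V \<subseteq> U))}"

definition character :: "'a topology \<Rightarrow> ('a set + nat) rel" where
  "character Y = card_sup (character_at Y ` topspace Y)"

definition weight :: "'a topology \<Rightarrow> ('a set + nat) rel" where
  "weight Y =
     card_min {|\<B>| | \<B>. (\<forall>V\<in>\<B>. openin Y V) \<and>
                        (\<forall>U y. openin Y U \<and> y \<in> U \<longrightarrow> (\<exists>V\<in>\<B>. y \<in> V \<and> V \<subseteq> U))} +c natLeq"

definition density_character :: "'a topology \<Rightarrow> ('a + nat) rel" where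
  "density_character Y = card_min {|D| | D. D \<subseteq> topspace Y \<and> Y closure_of D = topspace Y} +c natLeq"

definition condenses_onto :: "'a topology \<Rightarrow> 'b topology \<Rightarrow> bool" where
  "condenses_onto Y Z \<longleftrightarrow>
     (\<exists>f. continuous_map Y Z f \<and> inj_on f (topspace Y) \<and> f ` topspace Y = topspace Z)"

text \<open>
  The space \<open>Z\<close> ranges over topologies on the element type of \<open>Y\<close>. This is no restriction: a
  one-to-one map of \<open>Y\<close> onto \<open>Z\<close> transports the topology of \<open>Z\<close> to a homeomorphic one on
  \<open>topspace Y\<close>.
\<close>

definition condensation_min :: "('a topology \<Rightarrow> 'c rel) \<Rightarrow> 'a topology \<Rightarrow> 'c rel" where
  "condensation_min \<epsilon> Y = card_min {\<epsilon> Z | Z. tychonoff_space Z \<and> condenses_onto Y Z}"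

definition i_character :: "'a topology \<Rightarrow> ('a set + nat) rel" where
  "i_character = condensation_min character"

definition i_weight :: "'a topology \<Rightarrow> ('a set + nat) rel" where
  "i_weight = condensation_min weight"

section \<open>The Baire topology and function spaces\<close>

definition zero_sets :: "'a topology \<Rightarrow> 'a set set" where
  "zero_sets X = {{x \<in> topspace X. f x = 0} | f. continuous_map X euclideanreal f}"

definition baire_topology :: "'a topology \<Rightarrow> 'a topology" where
  "baire_topology X = topology (arbitrary union_of (\<lambda>Z. Z \<in> zero_sets X))"

lemma zero_sets_Int:
  assumes "S \<in> zero_sets X" "T \<in> zero_sets X"
  shows "S \<inter> T \<in> zero_sets X"
proof -
  obtain f where f: "continuous_map X euclideanreal f" "S = {x \<in> topspace X. f x = 0}"
    using assms(1) by (auto simp: zero_sets_def)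
  obtain g where g: "continuous_map X euclideanreal g" "T = {x \<in> topspace X. g x = 0}"
    using assms(2) by (auto simp: zero_sets_def)
  have 1: "continuous_map X euclideanreal (\<lambda>x. \<bar>f x\<bar> + \<bar>g x\<bar>)"
    by (intro continuous_map_add continuous_map_real_abs f g)
  have 2: "S \<inter> T = {x \<in> topspace X. \<bar>f x\<bar> + \<bar>g x\<bar> = 0}"
    unfolding f g by auto
  show ?thesis unfolding zero_sets_def 2
    using 1 by (intro CollectI exI[of _ "\<lambda>x. \<bar>f x\<bar> + \<bar>g x\<bar>"] conjI refl)
qed

lemma openin_baire_topology:
  "openin (baire_topology X) = arbitrary union_of (\<lambda>Z. Z \<in> zero_sets X)"
  unfolding baire_topology_def
  by (rule topology_inverse', rule istopology_base, rule zero_sets_Int)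

lemma topspace_baire_topology: "topspace (baire_topology X) = topspace X"
proof -
  have "topspace X \<in> zero_sets X"
    unfolding zero_sets_def by (rule CollectI, rule exI[of _ "\<lambda>x. 0"]) auto
  then have "openin (baire_topology X) (topspace X)"
    by (simp add: openin_baire_topology union_of_inc arbitrary_def)
  moreover have "Z \<subseteq> topspace X" if "Z \<in> zero_sets X" for Z
    using that by (auto simp: zero_sets_def)
  then have "topspace (baire_topology X) \<subseteq> topspace X"
    using openin_topspace[of "baire_topology X"]
    unfolding openin_baire_topology union_of_def by blast
  ultimately show ?thesis
    by (simp add: openin_subset subset_antisym)
qed

text \<open>
  Functions on the space \<open>X\<close> are represented by their extensional representatives, as in the
  product topology \<^term>\<open>powertop_real (topspace X)\<close>, which is the space of all real functions
  on \<open>X\<close> with pointwise convergence.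
\<close>

definition real_continuous_functions :: "'a topology \<Rightarrow> ('a \<Rightarrow> real) set" where
  "real_continuous_functions X =
     {f \<in> extensional (topspace X). continuous_map X euclideanreal f}"

definition zero_set_combinations :: "'a topology \<Rightarrow> ('a \<Rightarrow> real) set" where
  "zero_set_combinations X =
     {(\<lambda>x\<in>topspace X. \<Sum>i=1..k. real (n i) * indicator (Z i) x) |
        (k :: nat) (n :: nat \<Rightarrow> nat) (Z :: nat \<Rightarrow> 'a set). \<forall>i\<in>{1..k}. Z i \<in> zero_sets X}"

definition pointwise_topology :: "'a topology \<Rightarrow> ('a \<Rightarrow> real) set \<Rightarrow> ('a \<Rightarrow> real) topology" where
  "pointwise_topology X E = subtopology (powertop_real (topspace X)) E"

end

theory Submission
  imports Defs "HOL-Algebra.Free_Abelian_Groups" "HOL-Library.Countable_Set_Type"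
begin

text \<open>
  Write \<open>d\<close> for the density of the Baire topology. All four cardinals are squeezed between
  \<open>\<psi>(E)\<close> and \<open>iw(E)\<close>, and the theorem follows from \<open>iw(E) \<le> d \<le> \<psi>(E)\<close>.

  The inequalities \<open>\<psi>(E) \<le> i\<chi>(E) \<le> iw(E)\<close> and \<open>\<psi>(E) \<le> \<psi>w(E) \<le> iw(E)\<close> hold for every space that
  condenses onto a Tychonoff space \<open>Z\<close>: in the T1 space \<open>Z\<close> a point is the intersection of any
  of its neighbourhood bases, and the preimages of these neighbourhoods under the injective map
  have only one point in common
  (\<open>pseudocharacter_le_character_condensation\<close>, \<open>pseudoweight_le_weight_condensation\<close>).

  For \<open>iw(E) \<le> d\<close>, take a dense set \<open>D\<close> of least size in the Baire topology. Members of \<open>E\<close> are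
  continuous there, so they are determined by their values on \<open>D\<close>, and the restriction map is a
  condensation of \<open>E\<close> onto a subspace of \<open>\<real>\<^sup>D\<close> (\<open>restrict_dense_condenses\<close>), whose weight is at most
  \<open>\<bar>D\<bar> + \<omega>\<^sub>0\<close> (\<open>weight_subtopology_powertop_real\<close>).

  For \<open>d \<le> \<psi>(E)\<close> (\<open>density_le_pseudocharacter\<close>), let open sets intersect in the zero function alone.
  Each of them contains all members of \<open>E\<close> that vanish on a certain finite set; let \<open>D\<close> be the union
  of these finite sets, which is no larger than \<open>\<omega>\<^sub>0\<close> or the number of open sets. A nonempty
  zero-set \<open>Z\<close> that misses \<open>D\<close> would give a characteristic function, a member of \<open>E\<close>, which
  vanishes on \<open>D\<close> and hence lies in all those open sets without being zero. So \<open>D\<close> meets every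
  nonempty basic open set of the Baire topology.
\<close>

(* this notation for a closure with respect to an equivalence clashes with the topological one *)
no_notation eq_closure_of ("closure'_of\<index>")

section \<open>Cardinal functions through their witnessing families\<close>

lemma Cinfinite_csum_natLeq: "Cinfinite (p +c natLeq)"
  by (rule Cinfinite_csum[OF disjI2[OF natLeq_Cinfinite]])

lemma Cinfinite_card_sup:
  assumes "\<And>s. s \<in> K \<Longrightarrow> Card_order s"
  shows "Cinfinite (card_sup K)"
  by (rule conjI[OF cinfinite_mono[OF card_sup(2) natLeq_cinfinite] card_sup(1)]) (erule assms)+

text \<open>
  The cardinal functions are built from minimal sizes of families with a property \<open>P\<close>. For each of
  them two rules are derived, which free later arguments from minima and suprema: the value bounds
  the size of some family with \<open>P\<close>, and an infinite cardinal that bounds the sizes of such families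
  bounds the value.
\<close>

lemma card_min_card_of:
  assumes "P \<V>0"
  obtains \<V> where "P \<V>" "card_min {|\<V>| | \<V>. P \<V>} = |\<V>|"
proof -
  have "card_min {|\<V>| | \<V>. P \<V>} \<in> {|\<V>| | \<V>. P \<V>}"
    by (rule card_min(1)) (use assms card_of_Card_order in blast)+
  then obtain \<V> where "card_min {|\<V>| | \<V>. P \<V>} = |\<V>|" "P \<V>" by (elim CollectE exE conjE)
  then show thesis by (rule that[rotated])
qed

lemma card_min_card_of_le:
  assumes "P \<V>"
  shows "card_min {|\<V>| | \<V>. P \<V>} \<le>o |\<V>|"
  by (rule card_min(2)) (use assms card_of_Card_order in blast)+

lemma Card_order_card_min_card_of:
  assumes "P \<V>"
  shows "Card_order (card_min {|\<V>| | \<V>. P \<V>})"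
proof -
  obtain \<V>' where "card_min {|\<V>| | \<V>. P \<V>} = |\<V>'|"
    by (rule card_min_card_of[of P, OF assms])
  then show ?thesis by (simp only: card_of_Card_order)
qed

lemma card_min_csum_natLeq_witness:
  assumes "P \<V>0"
  obtains \<V> where "P \<V>" "|\<V>| \<le>o card_min {|\<V>| | \<V>. P \<V>} +c natLeq"
proof -
  obtain \<V> where \<V>: "P \<V>" "card_min {|\<V>| | \<V>. P \<V>} = |\<V>|"
    by (rule card_min_card_of[of P, OF assms])
  have "|\<V>| \<le>o card_min {|\<V>| | \<V>. P \<V>} +c natLeq"
    unfolding \<V>(2) by (rule ordLeq_csum1[OF card_of_Card_order])
  then show thesis by (rule that[OF \<V>(1)])
qed

lemma card_min_csum_natLeq_le:
  assumes "Cinfinite r" "P \<V>" "|\<V>| \<le>o r"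
  shows "card_min {|\<V>| | \<V>. P \<V>} +c natLeq \<le>o r"
  by (rule csum_cinfinite_bound[OF ordLeq_transitive[OF card_min_card_of_le[of P, OF assms(2)] assms(3)]
        natLeq_ordLeq_cinfinite[OF assms(1)] Card_order_card_min_card_of[of P, OF assms(2)]
        natLeq_Card_order assms(1)])

lemma t1_space_Inter_open_nbhds:
  assumes "t1_space Y" "y \<in> topspace Y"
  shows "\<Inter>{U. openin Y U \<and> y \<in> U} = {y}"
proof -
  have "x = y" if x: "x \<in> \<Inter>{U. openin Y U \<and> y \<in> U}" for x
  proof (rule ccontr)
    assume "x \<noteq> y"
    moreover have "x \<in> topspace Y" using x assms(2) by blast
    ultimately obtain U where "openin Y U" "y \<in> U" "x \<notin> U"
      using assms unfolding t1_space_def by metis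
    then show False using x by blast
  qed
  then show ?thesis by blast
qed

text \<open>
  The T1 axiom enters because \<^const>\<open>card_min\<close> is meaningful only for a nonempty set of cardinals:
  it makes the family of all open neighbourhoods of a point a candidate.
\<close>

lemma pseudocharacter_at_family:
  assumes "t1_space Y" "y \<in> topspace Y"
  obtains \<V> where "\<forall>V\<in>\<V>. openin Y V" "\<Inter>\<V> = {y}" "pseudocharacter_at Y y = |\<V>|"
proof -
  let ?P = "\<lambda>\<V>. (\<forall>V\<in>\<V>. openin Y V) \<and> \<Inter>\<V> = {y}"
  have "?P {U. openin Y U \<and> y \<in> U}"
    using t1_space_Inter_open_nbhds[OF assms] by simp
  then obtain \<V> where \<V>: "?P \<V>" "pseudocharacter_at Y y = |\<V>|"
    unfolding pseudocharacter_at_def by (rule card_min_card_of[of ?P])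
  show thesis
    by (rule that[OF conjunct1[OF \<V>(1)] conjunct2[OF \<V>(1)] \<V>(2)])
qed

lemma Card_order_pseudocharacter_at:
  assumes "t1_space Y" "y \<in> topspace Y"
  shows "Card_order (pseudocharacter_at Y y)"
  by (rule pseudocharacter_at_family[OF assms]) (simp only: card_of_Card_order)

lemma Cinfinite_pseudocharacter:
  assumes "t1_space Y"
  shows "Cinfinite (pseudocharacter Y)"
  unfolding pseudocharacter_def
  by (rule Cinfinite_card_sup) (use Card_order_pseudocharacter_at[OF assms] in blast)

lemma pseudocharacter_family:
  assumes "t1_space Y" "y \<in> topspace Y"
  obtains \<V> where "\<forall>V\<in>\<V>. openin Y V" "\<Inter>\<V> = {y}" "|\<V>| \<le>o pseudocharacter Y"
proof -
  obtain \<V> where \<V>: "\<forall>V\<in>\<V>. openin Y V" "\<Inter>\<V> = {y}" "pseudocharacter_at Y y = |\<V>|"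
    by (rule pseudocharacter_at_family[OF assms])
  have "pseudocharacter_at Y y \<le>o pseudocharacter Y"
    unfolding pseudocharacter_def
    by (rule card_sup(3)) (use assms(2) Card_order_pseudocharacter_at[OF assms(1)] in blast)+
  then show thesis by (rule that[OF \<V>(1,2), folded \<V>(3)])
qed

lemma pseudocharacter_le:
  assumes "Cinfinite r"
    and fam: "\<And>y. y \<in> topspace Y \<Longrightarrow> \<exists>\<V>. (\<forall>V\<in>\<V>. openin Y V) \<and> \<Inter>\<V> = {y} \<and> |\<V>| \<le>o r"
  shows "pseudocharacter Y \<le>o r"
proof -
  have at: "Card_order s \<and> s \<le>o r" if s: "s \<in> pseudocharacter_at Y ` topspace Y" for s
  proof -
    obtain y where y: "y \<in> topspace Y" "s = pseudocharacter_at Y y" using s by blast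
    let ?P = "\<lambda>\<V>. (\<forall>V\<in>\<V>. openin Y V) \<and> \<Inter>\<V> = {y}"
    obtain \<V> where \<V>: "?P \<V>" "|\<V>| \<le>o r" using fam[OF y(1)] by (elim exE conjE) blast
    show ?thesis
      unfolding y(2) pseudocharacter_at_def
      by (rule conjI[OF Card_order_card_min_card_of[of ?P, OF \<V>(1)]
            ordLeq_transitive[OF card_min_card_of_le[of ?P, OF \<V>(1)] \<V>(2)]])
  qed
  show ?thesis
    unfolding pseudocharacter_def
    by (rule card_sup(4)[OF conjunct1[OF at] conjunct2[OF assms(1)]
          natLeq_ordLeq_cinfinite[OF assms(1)] conjunct2[OF at]])
qed

lemma pseudoweight_family:
  assumes "t1_space Y"
  obtains \<V> where "\<forall>V\<in>\<V>. openin Y V" "\<forall>y\<in>topspace Y. \<Inter>{V\<in>\<V>. y \<in> V} = {y}"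
    "|\<V>| \<le>o pseudoweight Y"
proof -
  let ?P = "\<lambda>\<V>. (\<forall>V\<in>\<V>. openin Y V) \<and> (\<forall>y\<in>topspace Y. \<Inter>{V\<in>\<V>. y \<in> V} = {y})"
  have "?P {U. openin Y U}"
    using t1_space_Inter_open_nbhds[OF assms] by simp
  then obtain \<V> where \<V>: "?P \<V>" "|\<V>| \<le>o pseudoweight Y"
    unfolding pseudoweight_def by (rule card_min_csum_natLeq_witness[of ?P])
  show thesis
    by (rule that[OF conjunct1[OF \<V>(1)] conjunct2[OF \<V>(1)] \<V>(2)])
qed

lemma pseudoweight_le:
  assumes "Cinfinite r" "\<forall>V\<in>\<V>. openin Y V" "\<forall>y\<in>topspace Y. \<Inter>{V\<in>\<V>. y \<in> V} = {y}" "|\<V>| \<le>o r"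
  shows "pseudoweight Y \<le>o r"
  unfolding pseudoweight_def
  by (rule card_min_csum_natLeq_le[of r
        "\<lambda>\<V>. (\<forall>V\<in>\<V>. openin Y V) \<and> (\<forall>y\<in>topspace Y. \<Inter>{V\<in>\<V>. y \<in> V} = {y})",
        OF assms(1) conjI[OF assms(2,3)] assms(4)])

lemma Cinfinite_pseudoweight: "Cinfinite (pseudoweight Y)"
  unfolding pseudoweight_def by (rule Cinfinite_csum_natLeq)

definition nbhd_base :: "'a topology \<Rightarrow> 'a \<Rightarrow> 'a set set \<Rightarrow> bool" where
  "nbhd_base Y y \<B> \<longleftrightarrow> (\<forall>V\<in>\<B>. openin Y V \<and> y \<in> V) \<and> (\<forall>U. openin Y U \<and> y \<in> U \<longrightarrow> (\<exists>V\<in>\<B>. V \<subseteq> U))"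

definition open_base :: "'a topology \<Rightarrow> 'a set set \<Rightarrow> bool" where
  "open_base Y \<B> \<longleftrightarrow>
     (\<forall>V\<in>\<B>. openin Y V) \<and> (\<forall>U y. openin Y U \<and> y \<in> U \<longrightarrow> (\<exists>V\<in>\<B>. y \<in> V \<and> V \<subseteq> U))"

lemma open_base_imp_nbhd_base: "open_base Y \<B> \<Longrightarrow> nbhd_base Y y {V\<in>\<B>. y \<in> V}"
  unfolding open_base_def nbhd_base_def by blast

lemma character_at_nbhd_base:
  obtains \<B> where "nbhd_base Y y \<B>" "character_at Y y = |\<B>|"
proof -
  have "nbhd_base Y y {U. openin Y U \<and> y \<in> U}" unfolding nbhd_base_def by blast
  then obtain \<B> where "nbhd_base Y y \<B>" "card_min {|\<B>| | \<B>. nbhd_base Y y \<B>} = |\<B>|"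
    by (rule card_min_card_of[of "nbhd_base Y y"])
  then show thesis
    using that unfolding character_at_def nbhd_base_def[symmetric] by simp
qed

lemma character_at_le: "nbhd_base Y y \<B> \<Longrightarrow> character_at Y y \<le>o |\<B>|"
  unfolding character_at_def nbhd_base_def[symmetric] by (rule card_min_card_of_le)

lemma Card_order_character_at: "Card_order (character_at Y y)"
  by (rule character_at_nbhd_base[of Y y]) (simp add: card_of_Card_order)

lemma Cinfinite_character: "Cinfinite (character Y)"
  unfolding character_def by (rule Cinfinite_card_sup) (auto simp: Card_order_character_at)

lemma character_nbhd_base:
  assumes "y \<in> topspace Y"
  obtains \<B> where "nbhd_base Y y \<B>" "|\<B>| \<le>o character Y"
proof -
  have "character_at Y y \<le>o character Y"
    unfolding character_def by (rule card_sup(3)) (use assms in \<open>auto simp: Card_order_character_at\<close>)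
  moreover obtain \<B> where "nbhd_base Y y \<B>" "character_at Y y = |\<B>|"
    by (rule character_at_nbhd_base)
  ultimately show thesis using that by simp
qed

lemma weight_open_base:
  obtains \<B> where "open_base Y \<B>" "|\<B>| \<le>o weight Y"
proof -
  have "open_base Y {U. openin Y U}" unfolding open_base_def by blast
  then show thesis
    by (rule card_min_csum_natLeq_witness[of "open_base Y"])
      (rule that, assumption, simp add: weight_def open_base_def)
qed

lemma weight_le:
  assumes "Cinfinite r" "open_base Y \<B>" "|\<B>| \<le>o r"
  shows "weight Y \<le>o r"
  unfolding weight_def open_base_def[symmetric]
  by (rule card_min_csum_natLeq_le[of r "open_base Y", OF assms])

lemma Cinfinite_weight: "Cinfinite (weight Y)"
  unfolding weight_def by (rule Cinfinite_csum_natLeq)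

lemma density_character_dense_set:
  obtains D where "D \<subseteq> topspace Y" "Y closure_of D = topspace Y" "|D| \<le>o density_character Y"
proof -
  let ?P = "\<lambda>D. D \<subseteq> topspace Y \<and> Y closure_of D = topspace Y"
  have "?P (topspace Y)" by simp
  then obtain D where D: "?P D" "|D| \<le>o density_character Y"
    unfolding density_character_def by (rule card_min_csum_natLeq_witness[of ?P])
  show thesis
    by (rule that[OF conjunct1[OF D(1)] conjunct2[OF D(1)] D(2)])
qed

lemma density_character_le:
  assumes "Cinfinite r" "D \<subseteq> topspace Y" "Y closure_of D = topspace Y" "|D| \<le>o r"
  shows "density_character Y \<le>o r"
  unfolding density_character_def
  by (rule card_min_csum_natLeq_le[of r "\<lambda>D. D \<subseteq> topspace Y \<and> Y closure_of D = topspace Y",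
        OF assms(1) conjI[OF assms(2,3)] assms(4)])

lemma Cinfinite_density_character: "Cinfinite (density_character Y)"
  unfolding density_character_def by (rule Cinfinite_csum_natLeq)

lemma condensation_min_witness:
  fixes Y Z0 :: "'a topology"
  assumes "\<And>Z. Card_order (\<epsilon> Z)" "tychonoff_space Z0" "condenses_onto Y Z0"
  obtains Z where "tychonoff_space Z" "condenses_onto Y Z" "condensation_min \<epsilon> Y = \<epsilon> Z"
proof -
  let ?K = "{\<epsilon> Z | Z. tychonoff_space Z \<and> condenses_onto Y Z}"
  have "\<epsilon> Z0 \<in> ?K" using assms(2,3) by blast
  then have "?K \<noteq> {}" by blast
  then have "condensation_min \<epsilon> Y \<in> ?K"
    unfolding condensation_min_def by (rule card_min(1)) (auto simp: assms(1))
  then show thesis using that by blast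
qed

lemma condensation_min_le:
  assumes "\<And>Z. Card_order (\<epsilon> Z)" "tychonoff_space Z" "condenses_onto Y Z"
  shows "condensation_min \<epsilon> Y \<le>o \<epsilon> Z"
  unfolding condensation_min_def by (rule card_min(2)) (use assms in auto)

section \<open>General inequalities\<close>

text \<open>
  The two sides of this inequality and the next one are compared by selecting, for each point, the
  members of one global family that contain it.
\<close>

lemma character_le_weight: "character Z \<le>o weight Z"
proof -
  obtain \<B> where \<B>: "open_base Z \<B>" "|\<B>| \<le>o weight Z" by (rule weight_open_base)
  have at: "character_at Z z \<le>o weight Z" for z
  proof -
    have "|{V\<in>\<B>. z \<in> V}| \<le>o weight Z"
      by (rule ordLeq_transitive[OF card_of_mono1 \<B>(2)]) blast
    then show ?thesis
      by (rule ordLeq_transitive[OF character_at_le[OF open_base_imp_nbhd_base[OF \<B>(1)]]])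
  qed
  show ?thesis
    unfolding character_def
  proof (rule card_sup(4))
    show "Card_order s" "s \<le>o weight Z" if "s \<in> character_at Z ` topspace Z" for s
      using that Card_order_character_at[of Z] at by auto
    show "Card_order (weight Z)" "natLeq \<le>o weight Z"
      by (rule conjunct2[OF Cinfinite_weight], rule natLeq_ordLeq_cinfinite[OF Cinfinite_weight])
  qed
qed

lemma pseudocharacter_le_pseudoweight:
  assumes "t1_space Y"
  shows "pseudocharacter Y \<le>o pseudoweight Y"
proof -
  obtain \<V> where \<V>: "\<forall>V\<in>\<V>. openin Y V" "\<forall>y\<in>topspace Y. \<Inter>{V\<in>\<V>. y \<in> V} = {y}"
    "|\<V>| \<le>o pseudoweight Y"
    by (rule pseudoweight_family[OF assms])
  show ?thesis
  proof (rule pseudocharacter_le[OF Cinfinite_pseudoweight], intro exI conjI)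
    fix y assume y: "y \<in> topspace Y"
    show "\<forall>V\<in>{V\<in>\<V>. y \<in> V}. openin Y V" using \<V>(1) by blast
    show "\<Inter>{V\<in>\<V>. y \<in> V} = {y}" using \<V>(2) y by (rule bspec)
    show "|{V\<in>\<V>. y \<in> V}| \<le>o pseudoweight Y"
      by (rule ordLeq_transitive[OF card_of_mono1 \<V>(3)]) blast
  qed
qed

text \<open>
  This is the step that turns bases of the image space into separating families of the domain: a
  neighbourhood base of \<open>f y\<close> refines the family of all open neighbourhoods, which the T1 axiom
  shrinks to \<open>f y\<close>, and injectivity leaves \<open>y\<close> as the only preimage.
\<close>

lemma Inter_nbhd_base_vimage:
  assumes "t1_space Z" "inj_on f S" "y \<in> S" "f y \<in> topspace Z" "nbhd_base Z (f y) \<B>"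
  shows "\<Inter>((\<lambda>V. {x \<in> S. f x \<in> V}) ` \<B>) = {y}"
proof -
  have "x = y" if x: "x \<in> \<Inter>((\<lambda>V. {x \<in> S. f x \<in> V}) ` \<B>)" for x
  proof -
    \<comment> \<open>an empty family would have intersection \<^const>\<open>UNIV\<close>, not \<open>S\<close>\<close>
    obtain V0 where "V0 \<in> \<B>"
      using assms(4,5) unfolding nbhd_base_def by blast
    then have "x \<in> S" using x by blast
    have "f x \<in> \<Inter>{U. openin Z U \<and> f y \<in> U}"
      using x assms(5) unfolding nbhd_base_def by blast
    then have "f x = f y"
      using t1_space_Inter_open_nbhds[OF assms(1,4)] by blast
    then show ?thesis using \<open>x \<in> S\<close> assms(2,3) by (simp add: inj_on_eq_iff)
  qed
  moreover have "y \<in> \<Inter>((\<lambda>V. {x \<in> S. f x \<in> V}) ` \<B>)"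
    using assms(3,5) unfolding nbhd_base_def by blast
  ultimately show ?thesis by blast
qed

lemma
  assumes "t1_space Z" "condenses_onto Y Z"
  shows pseudocharacter_le_character_condensation: "pseudocharacter Y \<le>o character Z"
    and pseudoweight_le_weight_condensation: "pseudoweight Y \<le>o weight Z"
proof -
  obtain f where f: "continuous_map Y Z f" "inj_on f (topspace Y)" "f ` topspace Y = topspace Z"
    using assms(2) unfolding condenses_onto_def by blast
  define g where "g = (\<lambda>V. {x \<in> topspace Y. f x \<in> V})"
  have open_g: "openin Y (g V)" if "openin Z V" for V
    unfolding g_def by (rule openin_continuous_map_preimage[OF f(1) that])
  have Inter_g: "\<Inter>(g ` \<B>) = {y}" if "y \<in> topspace Y" "nbhd_base Z (f y) \<B>" for y \<B>
    unfolding g_def by (rule Inter_nbhd_base_vimage[OF assms(1) f(2)]) (use that f(3) in auto)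
  show "pseudocharacter Y \<le>o character Z"
  proof (rule pseudocharacter_le[OF Cinfinite_character])
    fix y assume y: "y \<in> topspace Y"
    then have "f y \<in> topspace Z" using f(3) by blast
    then obtain \<B> where \<B>: "nbhd_base Z (f y) \<B>" "|\<B>| \<le>o character Z"
      by (rule character_nbhd_base)
    have "\<forall>V\<in>g ` \<B>. openin Y V" using \<B>(1) open_g unfolding nbhd_base_def by blast
    moreover have "|g ` \<B>| \<le>o character Z"
      by (rule ordLeq_transitive[OF card_of_image \<B>(2)])
    ultimately show "\<exists>\<V>. (\<forall>V\<in>\<V>. openin Y V) \<and> \<Inter>\<V> = {y} \<and> |\<V>| \<le>o character Z"
      using Inter_g[OF y \<B>(1)] by blast
  qed
  obtain \<B> where \<B>: "open_base Z \<B>" "|\<B>| \<le>o weight Z" by (rule weight_open_base)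
  show "pseudoweight Y \<le>o weight Z"
  proof (rule pseudoweight_le[OF Cinfinite_weight])
    show "\<forall>V\<in>g ` \<B>. openin Y V" using \<B>(1) open_g unfolding open_base_def by blast
    show "|g ` \<B>| \<le>o weight Z" by (rule ordLeq_transitive[OF card_of_image \<B>(2)])
    show "\<forall>y\<in>topspace Y. \<Inter>{V \<in> g ` \<B>. y \<in> V} = {y}"
    proof
      fix y assume y: "y \<in> topspace Y"
      then have "{V \<in> g ` \<B>. y \<in> V} = g ` {V \<in> \<B>. f y \<in> V}" unfolding g_def by blast
      then show "\<Inter>{V \<in> g ` \<B>. y \<in> V} = {y}"
        using Inter_g[OF y open_base_imp_nbhd_base[OF \<B>(1)]] by simp
    qed
  qed
qed

section \<open>Subspaces of powers of the real line\<close>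

lemma finite_card_of_le:
  assumes "finite A" "Cinfinite r"
  shows "|A| \<le>o r"
  by (rule ordLeq_transitive[OF ordLess_imp_ordLeq natLeq_ordLeq_cinfinite[OF assms(2)]])
    (use assms(1) finite_iff_ordLess_natLeq in metis)

lemma card_of_Fpow_le:
  assumes "|A| \<le>o r" "Cinfinite r"
  shows "|Fpow A| \<le>o r"
proof (cases "finite A")
  case True
  then have "finite (Fpow A)" by (metis Fpow_subset_Pow finite_Pow_iff finite_subset)
  then show ?thesis using assms(2) by (rule finite_card_of_le)
next
  case False
  show ?thesis by (rule ordIso_ordLeq_trans[OF card_of_Fpow_infinite[OF False] assms(1)])
qed

text \<open>
  A basic open set of \<open>\<real>\<^sup>D\<close> is described by finitely many pairs of a coordinate and a member of a
  countable base of \<open>\<real>\<close>, so there are no more of them than finite subsets of \<open>D \<times> B\<close>.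
\<close>

lemma weight_subtopology_powertop_real:
  fixes D :: "'a set"
  assumes "Cinfinite r" "|D| \<le>o r"
  shows "weight (subtopology (powertop_real D) S) \<le>o r"
proof -
  obtain B :: "real set set" where B: "countable B" "topological_basis B"
    using ex_countable_basis by blast
  let ?Z = "subtopology (powertop_real D) S"
  define W where "W F = {f \<in> topspace ?Z. \<forall>(d, U)\<in>F. f d \<in> U}" for F :: "('a \<times> real set) set"
  have "open_base ?Z (W ` Fpow (D \<times> B))"
    unfolding open_base_def
  proof (intro conjI ballI allI impI)
    fix V assume "V \<in> W ` Fpow (D \<times> B)"
    then obtain F where F: "F \<subseteq> D \<times> B" "finite F" "V = W F" unfolding Fpow_def by blast
    have "openin ?Z {f \<in> topspace ?Z. f d \<in> U}" if "(d, U) \<in> F" for d U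
    proof (rule openin_continuous_map_preimage)
      show "continuous_map ?Z euclideanreal (\<lambda>f. f d)"
        using that F(1)
        by (intro continuous_map_from_subtopology continuous_map_product_projection) auto
      show "openin euclideanreal U"
        using that F(1) topological_basis_open[OF B(2)] by auto
    qed
    then have "openin ?Z (topspace ?Z \<inter> \<Inter>((\<lambda>(d, U). {f \<in> topspace ?Z. f d \<in> U}) ` F))"
      by (cases "F = {}") (auto intro!: openin_Int openin_Inter F(2) simp del: topspace_subtopology)
    moreover have "topspace ?Z \<inter> \<Inter>((\<lambda>(d, U). {f \<in> topspace ?Z. f d \<in> U}) ` F) = V"
      unfolding F(3) W_def by auto
    ultimately show "openin ?Z V" by simp
  next
    fix O' g assume "openin ?Z O' \<and> g \<in> O'"
    then obtain T where T: "openin (powertop_real D) T" "O' = T \<inter> S" "g \<in> T" "g \<in> S"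
      unfolding openin_subtopology by blast
    obtain U where U: "finite {i \<in> D. U i \<noteq> UNIV}" "\<forall>i\<in>D. open (U i)" "g \<in> Pi\<^sub>E D U" "Pi\<^sub>E D U \<subseteq> T"
      using T(1,3) unfolding openin_product_topology_alt by auto
    have "\<exists>b\<in>B. g i \<in> b \<and> b \<subseteq> U i" if "i \<in> D" for i
      using topological_basisE[OF B(2)] U(2,3) that by (metis PiE_mem)
    then obtain b where b: "\<And>i. i \<in> D \<Longrightarrow> b i \<in> B \<and> g i \<in> b i \<and> b i \<subseteq> U i" by metis
    define F where "F = (\<lambda>i. (i, b i)) ` {i \<in> D. U i \<noteq> UNIV}"
    have "F \<in> Fpow (D \<times> B)" unfolding Fpow_def F_def using U(1) b by auto
    moreover have "g \<in> W F"
      using T(4) U(3) b unfolding W_def F_def by (auto simp: PiE_iff)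
    moreover have "W F \<subseteq> O'"
    proof
      fix f assume f: "f \<in> W F"
      have "f i \<in> U i" if "i \<in> D" for i
        using f b[OF that] that unfolding W_def F_def by (cases "U i = UNIV") auto
      then have "f \<in> Pi\<^sub>E D U" using f unfolding W_def by (auto simp: PiE_iff)
      then show "f \<in> O'" using f U(4) T(2) unfolding W_def by auto
    qed
    ultimately show "\<exists>V\<in>W ` Fpow (D \<times> B). g \<in> V \<and> V \<subseteq> O'" by blast
  qed
  moreover have "|W ` Fpow (D \<times> B)| \<le>o r"
  proof (rule ordLeq_transitive[OF card_of_image card_of_Fpow_le[OF _ assms(1)]])
    have "|B| \<le>o natLeq"
      using B(1) unfolding countable_card_le_natLeq .
    then have "|B| \<le>o r"
      using natLeq_ordLeq_cinfinite[OF assms(1)] by (rule ordLeq_transitive)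
    with assms(2) show "|D \<times> B| \<le>o r"
      using assms(1) unfolding cinfinite_def
      by (intro card_of_Times_ordLeq_infinite_Field) auto
  qed
  ultimately show ?thesis by (rule weight_le[OF assms(1)])
qed

lemma tychonoff_subtopology_powertop_real:
  "tychonoff_space (subtopology (powertop_real D) S)"
  unfolding tychonoff_space_def
  by (intro conjI completely_regular_space_subtopology t1_space_subtopology)
    (auto simp: completely_regular_space_product_topology t1_space_product_topology
      t1_space_euclidean metrizable_space_euclidean metrizable_imp_completely_regular_space)

text \<open>
  The restriction is injective because a continuous function is determined by its values on a
  dense set, and continuous because it only forgets coordinates.
\<close>

lemma restrict_dense_condenses:
  assumes "E \<subseteq> real_continuous_functions Y" "D \<subseteq> topspace Y" "Y closure_of D = topspace Y"
  shows "condenses_onto (pointwise_topology Y E)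
           (subtopology (powertop_real D) ((\<lambda>f. restrict f D) ` E))"
  unfolding condenses_onto_def
proof (intro exI conjI)
  have E: "E \<subseteq> extensional (topspace Y)"
    using assms(1) unfolding real_continuous_functions_def by blast
  have top: "topspace (pointwise_topology Y E) = E"
    using E unfolding pointwise_topology_def by (auto simp: PiE_def)
  show "continuous_map (pointwise_topology Y E)
          (subtopology (powertop_real D) ((\<lambda>f. restrict f D) ` E)) (\<lambda>f. restrict f D)"
  proof (rule continuous_map_into_subtopology)
    show "continuous_map (pointwise_topology Y E) (powertop_real D) (\<lambda>f. restrict f D)"
      unfolding pointwise_topology_def continuous_map_componentwise
      using assms(2)
      by (auto intro!: continuous_map_from_subtopology continuous_map_product_projection)
    show "(\<lambda>f. restrict f D) \<in> topspace (pointwise_topology Y E) \<rightarrow> (\<lambda>f. restrict f D) ` E"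
      unfolding top by blast
  qed
  show "inj_on (\<lambda>f. restrict f D) (topspace (pointwise_topology Y E))"
    unfolding top
  proof (rule inj_onI)
    fix f g assume fg: "f \<in> E" "g \<in> E" "restrict f D = restrict g D"
    then have c: "continuous_map Y euclideanreal f" "continuous_map Y euclideanreal g"
      using assms(1) unfolding real_continuous_functions_def by auto
    have eq: "f x = g x" if "x \<in> D" for x
      using fg(3) that by (metis restrict_apply')
    show "f = g"
    proof (rule extensionalityI)
      show "f \<in> extensional (topspace Y)" "g \<in> extensional (topspace Y)" using E fg by auto
      show "f x = g x" if "x \<in> topspace Y" for x
        using forall_in_closure_of_eq[of x Y D euclideanreal f g] that assms(3) c eq by auto
    qed
  qed
  show "(\<lambda>f. restrict f D) ` topspace (pointwise_topology Y E)
      = topspace (subtopology (powertop_real D) ((\<lambda>f. restrict f D) ` E))"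
    unfolding top by auto
qed

section \<open>Neighbourhoods of the zero function and the density of the Baire topology\<close>

lemma pointwise_open_finite_support:
  assumes "openin (pointwise_topology X E) V" "f \<in> V" "E \<subseteq> extensional (topspace X)"
  shows "\<exists>F. finite F \<and> F \<subseteq> topspace X \<and> (\<forall>g\<in>E. (\<forall>x\<in>F. g x = f x) \<longrightarrow> g \<in> V)"
proof -
  obtain T where T: "openin (powertop_real (topspace X)) T" "V = T \<inter> E"
    using assms(1) unfolding pointwise_topology_def openin_subtopology by blast
  then obtain U where U: "finite {i \<in> topspace X. U i \<noteq> UNIV}" "f \<in> Pi\<^sub>E (topspace X) U"
      "Pi\<^sub>E (topspace X) U \<subseteq> T"
    using assms(2) unfolding openin_product_topology_alt by auto
  have "g \<in> V" if g: "g \<in> E" "\<forall>x\<in>{i \<in> topspace X. U i \<noteq> UNIV}. g x = f x" for g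
  proof -
    have "g i \<in> U i" if "i \<in> topspace X" for i
      using g(2) U(2) that by (cases "U i = UNIV") (auto simp: PiE_iff)
    then have "g \<in> Pi\<^sub>E (topspace X) U" using g(1) assms(3) by (auto simp: PiE_iff)
    then show ?thesis using U(3) T(2) g(1) by blast
  qed
  then show ?thesis using U(1) by (intro exI[of _ "{i \<in> topspace X. U i \<noteq> UNIV}"]) auto
qed

lemma openin_baire_topology_zero_set:
  assumes "openin (baire_topology X) T" "x \<in> T"
  obtains Z where "Z \<in> zero_sets X" "x \<in> Z" "Z \<subseteq> T"
proof -
  obtain \<U> where \<U>: "\<U> \<subseteq> zero_sets X" "\<Union>\<U> = T"
    using assms(1) unfolding openin_baire_topology union_of_def subset_eq by auto
  then obtain Z where "Z \<in> \<U>" "x \<in> Z" using assms(2) by blast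
  with \<U> show thesis by (intro that[of Z]) auto
qed

lemma dense_in_baire_topology:
  assumes "\<And>Z. Z \<in> zero_sets X \<Longrightarrow> Z \<noteq> {} \<Longrightarrow> Z \<inter> D \<noteq> {}"
  shows "baire_topology X closure_of D = topspace (baire_topology X)"
proof (rule antisym[OF closure_of_subset_topspace subsetI])
  fix x assume x: "x \<in> topspace (baire_topology X)"
  have "\<exists>y. y \<in> D \<and> y \<in> T" if T: "openin (baire_topology X) T" "x \<in> T" for T
  proof -
    obtain Z where Z: "Z \<in> zero_sets X" "x \<in> Z" "Z \<subseteq> T"
      by (rule openin_baire_topology_zero_set[OF T])
    then have "Z \<inter> D \<noteq> {}" by (intro assms) auto
    then show ?thesis using Z(3) by blast
  qed
  then show "x \<in> baire_topology X closure_of D"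
    using x by (auto simp only: in_closure_of)
qed

lemma zero_in_zero_set_combinations: "(\<lambda>x\<in>topspace X. 0) \<in> zero_set_combinations X"
  unfolding zero_set_combinations_def by (rule CollectI, rule exI[of _ 0]) simp

lemma indicator_in_zero_set_combinations:
  assumes "Z \<in> zero_sets X"
  shows "(\<lambda>x\<in>topspace X. indicator Z x) \<in> zero_set_combinations X"
  unfolding zero_set_combinations_def
  by (rule CollectI, rule exI[of _ 1], rule exI[of _ "\<lambda>_. 1"], rule exI[of _ "\<lambda>_. Z"])
    (use assms in simp)

text \<open>
  The pseudocharacter is bounded from below at the zero function, which is the empty combination
  of zero-sets. Characteristic functions of zero-sets detect that the finite sets of coordinates
  that guarantee membership in its neighbourhoods have a dense union.
\<close>

lemma density_le_pseudocharacter: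
  assumes "zero_set_combinations X \<subseteq> E" "E \<subseteq> extensional (topspace X)"
    and t1: "t1_space (pointwise_topology X E)"
  shows "density_character (baire_topology X) \<le>o pseudocharacter (pointwise_topology X E)"
proof -
  let ?Y = "pointwise_topology X E" and ?o = "\<lambda>x\<in>topspace X. 0 :: real"
  have "?o \<in> E" by (rule subsetD[OF assms(1) zero_in_zero_set_combinations])
  then have "?o \<in> topspace ?Y"
    unfolding pointwise_topology_def by simp
  then obtain \<V> where \<V>: "\<forall>V\<in>\<V>. openin ?Y V" "\<Inter>\<V> = {?o}" "|\<V>| \<le>o pseudocharacter ?Y"
    by (rule pseudocharacter_family[OF t1])
  have "\<forall>V\<in>\<V>. \<exists>F. finite F \<and> F \<subseteq> topspace X \<and> (\<forall>g\<in>E. (\<forall>x\<in>F. g x = ?o x) \<longrightarrow> g \<in> V)"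
  proof
    fix V assume V: "V \<in> \<V>"
    have "?o \<in> V" using V \<V>(2) by blast
    with bspec[OF \<V>(1) V] show "\<exists>F. finite F \<and> F \<subseteq> topspace X \<and> (\<forall>g\<in>E. (\<forall>x\<in>F. g x = ?o x) \<longrightarrow> g \<in> V)"
      using assms(2) by (rule pointwise_open_finite_support)
  qed
  from bchoice[OF this] obtain F
    where "\<forall>V\<in>\<V>. finite (F V) \<and> F V \<subseteq> topspace X \<and> (\<forall>g\<in>E. (\<forall>x\<in>F V. g x = ?o x) \<longrightarrow> g \<in> V)"
    by (elim exE)
  then have F: "\<And>V. V \<in> \<V> \<Longrightarrow> finite (F V) \<and> F V \<subseteq> topspace X"
      "\<And>V g. V \<in> \<V> \<Longrightarrow> g \<in> E \<Longrightarrow> \<forall>x\<in>F V. g x = ?o x \<Longrightarrow> g \<in> V"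
    by (simp_all only:)
  define D where "D = (\<Union>V\<in>\<V>. F V)"
  have DX: "D \<subseteq> topspace X" using F(1) unfolding D_def by blast
  have inf: "Cinfinite (pseudocharacter ?Y)" by (rule Cinfinite_pseudocharacter[OF t1])
  show ?thesis
  proof (rule density_character_le[OF inf])
    show "D \<subseteq> topspace (baire_topology X)" using DX by (simp add: topspace_baire_topology)
    show "baire_topology X closure_of D = topspace (baire_topology X)"
    proof (rule dense_in_baire_topology)
      fix Z assume Z: "Z \<in> zero_sets X" "Z \<noteq> {}"
      show "Z \<inter> D \<noteq> {}"
      proof
        assume disj: "Z \<inter> D = {}"
        let ?f = "\<lambda>x\<in>topspace X. indicator Z x :: real"
        have fE: "?f \<in> E" using indicator_in_zero_set_combinations[OF Z(1)] assms(1) by blast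
        have "?f x = ?o x" if "V \<in> \<V>" "x \<in> F V" for V x
          using that disj unfolding D_def by (auto simp: restrict_def indicator_def)
        then have "?f \<in> V" if "V \<in> \<V>" for V
          by (rule F(2)[OF that fE ballI[OF _]]) (rule that)
        then have "?f \<in> \<Inter>\<V>" by (rule InterI)
        then have "?f = ?o" unfolding \<V>(2) by (rule singletonD)
        moreover obtain z where z: "z \<in> Z" "z \<in> topspace X"
          using Z unfolding zero_sets_def by blast
        ultimately have "?f z = ?o z" by (simp only:)
        then show False using z by simp
      qed
    qed
    have "|F V| \<le>o pseudocharacter ?Y" if "V \<in> \<V>" for V
      by (rule finite_card_of_le[OF conjunct1[OF F(1)[OF that]] inf])
    then show "|D| \<le>o pseudocharacter ?Y"
      using inf unfolding D_def cinfinite_def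
      by (intro card_of_UNION_ordLeq_infinite_Field[OF _ _ \<V>(3)] ballI) simp_all
  qed
qed

theorem theorem8p1:
  fixes X :: "'a topology" and E :: "('a \<Rightarrow> real) set"
  assumes "tychonoff_space X"
    and "zero_set_combinations X \<subseteq> E"
    and "E \<subseteq> real_continuous_functions (baire_topology X)"
  shows "pseudocharacter (pointwise_topology X E) =o density_character (baire_topology X)
       \<and> pseudoweight (pointwise_topology X E) =o density_character (baire_topology X)
       \<and> i_character (pointwise_topology X E) =o density_character (baire_topology X)
       \<and> i_weight (pointwise_topology X E) =o density_character (baire_topology X)"
proof -
  let ?Y = "pointwise_topology X E" and ?B = "baire_topology X"
  let ?d = "density_character ?B"
  \<comment> \<open>pointwise convergence depends only on the set of points, so \<open>E\<close> may be viewed as a space of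
      continuous functions on the Baire topology\<close>
  have Y: "?Y = pointwise_topology ?B E"
    by (simp add: pointwise_topology_def topspace_baire_topology)
  have ext: "E \<subseteq> extensional (topspace X)"
    using assms(3) unfolding real_continuous_functions_def topspace_baire_topology by blast
  have t1: "t1_space ?Y"
    using tychonoff_subtopology_powertop_real[of "topspace X" E]
    unfolding pointwise_topology_def tychonoff_space_def by (rule conjunct2)
  obtain D where D: "D \<subseteq> topspace ?B" "?B closure_of D = topspace ?B" "|D| \<le>o ?d"
    by (rule density_character_dense_set)
  define Z where "Z = subtopology (powertop_real D) ((\<lambda>f. restrict f D) ` E)"
  have Z: "tychonoff_space Z" "condenses_onto ?Y Z" "weight Z \<le>o ?d"
    unfolding Z_def Y
    by (rule tychonoff_subtopology_powertop_real restrict_dense_condenses[OF assms(3) D(1,2)]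
        weight_subtopology_powertop_real[OF Cinfinite_density_character D(3)])+
  have co: "\<And>Z :: ('a \<Rightarrow> real) topology. Card_order (character Z)"
      "\<And>Z :: ('a \<Rightarrow> real) topology. Card_order (weight Z)"
    by (rule conjunct2[OF Cinfinite_character] conjunct2[OF Cinfinite_weight])+
  obtain Zc where Zc: "tychonoff_space Zc" "condenses_onto ?Y Zc" "i_character ?Y = character Zc"
    unfolding i_character_def by (rule condensation_min_witness[OF co(1) Z(1,2)])
  obtain Zw where Zw: "tychonoff_space Zw" "condenses_onto ?Y Zw" "i_weight ?Y = weight Zw"
    unfolding i_weight_def by (rule condensation_min_witness[OF co(2) Z(1,2)])
  have d_psi: "?d \<le>o pseudocharacter ?Y"
    by (rule density_le_pseudocharacter[OF assms(2) ext t1])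
  have psi_psiw: "pseudocharacter ?Y \<le>o pseudoweight ?Y"
    by (rule pseudocharacter_le_pseudoweight[OF t1])
  have psi_ichi: "pseudocharacter ?Y \<le>o i_character ?Y"
    unfolding Zc(3)
    by (rule pseudocharacter_le_character_condensation[OF _ Zc(2)])
      (use Zc(1) in \<open>simp add: tychonoff_space_def\<close>)
  have psiw_iw: "pseudoweight ?Y \<le>o i_weight ?Y"
    unfolding Zw(3)
    by (rule pseudoweight_le_weight_condensation[OF _ Zw(2)])
      (use Zw(1) in \<open>simp add: tychonoff_space_def\<close>)
  have ichi_iw: "i_character ?Y \<le>o i_weight ?Y"
    unfolding Zw(3) i_character_def
    by (rule ordLeq_transitive[OF condensation_min_le[of character, OF co(1) Zw(1,2)] character_le_weight])
  have iw_d: "i_weight ?Y \<le>o ?d"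
    unfolding i_weight_def
    by (rule ordLeq_transitive[OF condensation_min_le[of weight, OF co(2) Z(1,2)] Z(3)])
  have ichi_d: "i_character ?Y \<le>o ?d" by (rule ordLeq_transitive[OF ichi_iw iw_d])
  have psiw_d: "pseudoweight ?Y \<le>o ?d" by (rule ordLeq_transitive[OF psiw_iw iw_d])
  have psi_d: "pseudocharacter ?Y \<le>o ?d" by (rule ordLeq_transitive[OF psi_psiw psiw_d])
  have d_psiw: "?d \<le>o pseudoweight ?Y" by (rule ordLeq_transitive[OF d_psi psi_psiw])
  have d_ichi: "?d \<le>o i_character ?Y" by (rule ordLeq_transitive[OF d_psi psi_ichi])
  have d_iw: "?d \<le>o i_weight ?Y" by (rule ordLeq_transitive[OF d_ichi ichi_iw])
  show ?thesis
    unfolding ordIso_iff_ordLeq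
    by (intro conjI psi_d psiw_d ichi_d iw_d d_psi d_psiw d_ichi d_iw)
qed

end
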